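(* For each odd positive integer $n \geq 5$, there exist connected graphs $G_1$ and $G_2$ such that $\chi(G_1)=2$, $\chi^{\mathrm{FAT}}(G_1)=n$, $\chi(G_2)=n$, and $\chi^{\mathrm{FAT}}(G_2)=2$.
   Context: All graphs are simple with a finite nonempty vertex set. $\chi(G)$ denotes the chromatic number of $G$. For a vertex $v$ and a set $S\subseteq V(G)$, let $e(v,S)=|S\cap N(v)|$, where $N(v)$ is the set of neighbors of $v$ and $\deg(v)=|N(v)|$. A (not necessarily proper) vertex coloring of $G$ with color classes $V_1,\dots,V_k$ is a Fair And Tolerant (FAT) $k$-coloring if $V_1,\dots,V_k$ are all nonempty, they partition $V(G)$, and there exist real numbers $\alpha,\beta\in[0,1]$ such that for every vertex $v$ and every $i\in\{1,\dots,k\}$: $e(v,V_i)=\alpha\deg(v)$ if $v\notin V_i$, and $e(v,V_i)=\beta\deg(v)$ if $v\in V_i$. The FAT chromatic number $\chi^{\mathrm{FAT}}(G)$ is the maximum $k$ such that $G$ admits a FAT $k$-coloring (a FAT $1$-coloring always exists). *)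

theory Defs
  imports
    Complex_Main
    "HOL-Library.Disjoint_Sets"
    "Graph_Theory.Graph_Theory"
begin

text \<open>
  Finite simple graphs are the \<^locale>\<open>pair_graph\<close>s of the library: finite, loop-free digraphs whose
  arcs form a symmetric set of pairs, so that an edge uv is the pair of arcs (u,v) and (v,u).
  Nonemptiness of the vertex set is part of \<^const>\<open>Digraph_Component.connected\<close>.
\<close>

definition nbhd :: "'a pair_pre_digraph \<Rightarrow> 'a \<Rightarrow> 'a set" where
  "nbhd G v = {u \<in> pverts G. (v, u) \<in> parcs G}"

definition vdeg :: "'a pair_pre_digraph \<Rightarrow> 'a \<Rightarrow> nat" where
  "vdeg G v = card (nbhd G v)"

definition edges_to :: "'a pair_pre_digraph \<Rightarrow> 'a \<Rightarrow> 'a set \<Rightarrow> nat" where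
  "edges_to G v S = card (S \<inter> nbhd G v)"

definition proper_coloring :: "'a pair_pre_digraph \<Rightarrow> nat \<Rightarrow> ('a \<Rightarrow> nat) \<Rightarrow> bool" where
  "proper_coloring G k c \<longleftrightarrow>
     c ` pverts G \<subseteq> {1..k} \<and> (\<forall>(u, v) \<in> parcs G. c u \<noteq> c v)"

definition chromatic_number :: "'a pair_pre_digraph \<Rightarrow> nat" where
  "chromatic_number G = (LEAST k. \<exists>c. proper_coloring G k c)"

definition FAT_coloring :: "'a pair_pre_digraph \<Rightarrow> nat \<Rightarrow> (nat \<Rightarrow> 'a set) \<Rightarrow> bool" where
  "FAT_coloring G k V \<longleftrightarrow>
     (\<forall>i\<in>{1..k}. V i \<noteq> {}) \<and>
     disjoint_family_on V {1..k} \<and>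
     (\<Union>i\<in>{1..k}. V i) = pverts G \<and>
     (\<exists>\<alpha>\<in>{0..1::real}. \<exists>\<beta>\<in>{0..1::real}. \<forall>v\<in>pverts G. \<forall>i\<in>{1..k}.
        (v \<notin> V i \<longrightarrow> real (edges_to G v (V i)) = \<alpha> * real (vdeg G v)) \<and>
        (v \<in> V i \<longrightarrow> real (edges_to G v (V i)) = \<beta> * real (vdeg G v)))"

definition FAT_chromatic_number :: "'a pair_pre_digraph \<Rightarrow> nat" where
  "FAT_chromatic_number G = Max {k. \<exists>V. FAT_coloring G k V}"

text \<open>
  The minimum and the maximum above are taken over a nonempty set and a nonempty finite set,
  respectively.
\<close>

lemma ex_proper_coloring:
  assumes "pair_graph G"
  shows "\<exists>k c. proper_coloring G k c"
proof -
  interpret pair_graph G by fact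
  obtain h where h: "bij_betw h (pverts G) {1..card (pverts G)}"
    using finite_same_card_bij[of "pverts G" "{1..card (pverts G)}"] by auto
  have "h u \<noteq> h v" if "(u, v) \<in> parcs G" for u v
  proof -
    have "u \<in> pverts G" "v \<in> pverts G" "u \<noteq> v"
      using that in_arcsD1[OF that] in_arcsD2[OF that] no_loops'[OF that] by auto
    then show ?thesis using h by (auto simp: bij_betw_def inj_on_def)
  qed
  then have "proper_coloring G (card (pverts G)) h"
    using h by (auto simp: proper_coloring_def bij_betw_def)
  then show ?thesis by blast
qed

lemma ex_FAT_coloring_1:
  assumes "pverts G \<noteq> {}"
  shows "\<exists>V. FAT_coloring G 1 V"
proof -
  have "pverts G \<inter> nbhd G v = nbhd G v" for v
    by (auto simp: nbhd_def)
  then have "FAT_coloring G 1 (\<lambda>_. pverts G)"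
    using assms by (auto simp: FAT_coloring_def disjoint_family_on_def edges_to_def vdeg_def
        intro!: bexI[of _ 0] bexI[of _ 1])
  then show ?thesis by blast
qed

lemma FAT_coloring_le_card:
  assumes "finite (pverts G)" "FAT_coloring G k V"
  shows "k \<le> card (pverts G)"
proof -
  have ne: "V i \<noteq> {}" if "i \<in> {1..k}" for i
    using assms that by (auto simp: FAT_coloring_def)
  have U: "(\<Union>i\<in>{1..k}. V i) = pverts G" and d: "disjoint_family_on V {1..k}"
    using assms by (auto simp: FAT_coloring_def)
  define f where "f i = (SOME x. x \<in> V i)" for i
  have f: "f i \<in> V i" if "i \<in> {1..k}" for i
    unfolding f_def using ne[OF that] by (auto intro: someI_ex)
  have "inj_on f {1..k}"
  proof (rule inj_onI)
    fix i j assume ij: "i \<in> {1..k}" "j \<in> {1..k}" "f i = f j"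
    have "f i \<in> V i \<inter> V j" using f[OF ij(1)] f[OF ij(2)] ij(3) by simp
    then show "i = j" using d ij(1,2) unfolding disjoint_family_on_def by blast
  qed
  moreover have "f ` {1..k} \<subseteq> pverts G" using f U by blast
  ultimately have "card {1..k} \<le> card (pverts G)"
    using assms(1) by (intro card_inj_on_le)
  then show ?thesis by simp
qed

lemma finite_FAT_colorings:
  assumes "finite (pverts G)"
  shows "finite {k. \<exists>V. FAT_coloring G k V}"
  by (rule finite_subset[of _ "{..card (pverts G)}"]) (auto intro: FAT_coloring_le_card[OF assms])

end

theory Submission
  imports Defs
begin

text \<open>
  In a connected graph with a FAT coloring by at least two colors the parameter \<alpha> is positive,
  for otherwise a color class would be closed under adjacency. Hence every vertex has a neighbor
  in each class other than its own, so that k is at most deg v + 1 for every vertex v, and equality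
  for one v forces \<beta> = 0, i.e. a proper coloring.

  For the first graph take the complete bipartite graph on n + n vertices: pairing the two sides
  gives n classes, and n + 1 classes would each lie in one side, which is impossible.
  For the second graph take the complete graph on n vertices with a pendant vertex and replace each
  vertex by two independent copies: separating the copies gives two classes with
  \<alpha> = \<beta> = 1/2. The copies of the pendant vertex have degree 2, so three
  classes would form a proper coloring of a graph with a clique on four vertices.
\<close>

section \<open>Connected graphs and color classes\<close>

text \<open>Arcs are symmetric, so connectedness gives a directed path from a point of
  \<open>S\<close> to any vertex, and induction along it never leaves \<open>S\<close>.\<close>

lemma connected_closed_set:
  assumes "pair_graph G" "Digraph_Component.connected G"
    and "S \<subseteq> pverts G" "S \<noteq> {}"
    and closed: "\<And>v u. v \<in> S \<Longrightarrow> (v, u) \<in> parcs G \<Longrightarrow> u \<in> S"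
  shows "S = pverts G"
proof -
  interpret pair_graph G by fact
  obtain s where s: "s \<in> S" using assms by blast
  have "w \<in> S" if "w \<in> pverts G" for w
  proof -
    have "strongly_connected G"
      using assms(2) symmetric_connected_imp_strongly_connected pair_sym_arcs by blast
    then have "s \<rightarrow>\<^sup>*\<^bsub>with_proj G\<^esub> w"
      using that s assms(3) unfolding strongly_connected_def by auto
    then show ?thesis
      by (induction rule: reachable_induct) (use s closed in auto)
  qed
  then show ?thesis using assms(3) by blast
qed

text \<open>Any two vertices are joined through \<open>r\<close>, reversing one of the walks by
  symmetry. Both graphs below have such a center within distance two of every vertex.\<close>

lemma connected_if_near_vertex:
  assumes "pair_graph G" "r \<in> pverts G"
    and near: "\<And>v. v \<in> pverts G \<Longrightarrow>
      v = r \<or> (v, r) \<in> parcs G \<or> (\<exists>w. (v, w) \<in> parcs G \<and> (w, r) \<in> parcs G)"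
  shows "Digraph_Component.connected G"
proof -
  interpret pair_graph G by fact
  have r: "v \<rightarrow>\<^sup>*\<^bsub>with_proj G\<^esub> r" if "v \<in> pverts G" for v
    using near[OF that] that
    by (metis adj_reachable_trans assms(2) reachable_adjI reachable_refl with_proj_simps(3))
  have "v \<rightarrow>\<^sup>*\<^bsub>with_proj G\<^esub> w" if "v \<in> pverts G" "w \<in> pverts G" for v w
    using r[OF that(1)] symmetric_reachable'[OF r[OF that(2)]] by (rule reachable_trans)
  then show ?thesis
    using assms(2) reachable_mk_symmetricI
    by (auto simp: Digraph_Component.connected_def strongly_connected_def)
qed

section \<open>Degree counts along the classes of a FAT coloring\<close>

lemma sum_edges_to_classes:
  assumes "finite (pverts G)" "FAT_coloring G k V"
  shows "(\<Sum>i\<in>{1..k}. edges_to G v (V i)) = vdeg G v"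
proof -
  have fin: "finite (nbhd G v)" using assms(1) by (simp add: nbhd_def)
  have disj: "disjoint_family_on V {1..k}" and U: "(\<Union>i\<in>{1..k}. V i) = pverts G"
    using assms(2) by (auto simp: FAT_coloring_def)
  have "nbhd G v = (\<Union>i\<in>{1..k}. V i \<inter> nbhd G v)"
    using U by (auto simp: nbhd_def)
  then have "vdeg G v = card (\<Union>i\<in>{1..k}. V i \<inter> nbhd G v)"
    by (simp add: vdeg_def)
  also have "\<dots> = (\<Sum>i\<in>{1..k}. card (V i \<inter> nbhd G v))"
    using fin disj by (intro card_UN_disjoint) (auto simp: disjoint_family_on_def)
  finally show ?thesis by (simp add: edges_to_def)
qed

text \<open>With a single class no vertex lies outside it and \<alpha> is unconstrained; the
  arguments here start from two classes.\<close>

locale connected_FAT =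
  fixes G :: "'a pair_pre_digraph" and k :: nat and V :: "nat \<Rightarrow> 'a set"
  assumes graph: "pair_graph G" and conn: "Digraph_Component.connected G"
    and FAT: "FAT_coloring G k V" and k2: "k \<ge> 2"
begin

lemma finite_pverts: "finite (pverts G)"
  using graph pair_fin_digraph.pair_finite_verts
  by (auto simp: pair_graph_def pair_digraph_def)

lemma class_ne: "i \<in> {1..k} \<Longrightarrow> V i \<noteq> {}"
  using FAT by (auto simp: FAT_coloring_def)

lemma class_disjoint: "i \<in> {1..k} \<Longrightarrow> j \<in> {1..k} \<Longrightarrow> i \<noteq> j \<Longrightarrow> V i \<inter> V j = {}"
  using FAT by (auto simp: FAT_coloring_def disjoint_family_on_def)

lemma class_sub: "i \<in> {1..k} \<Longrightarrow> V i \<subseteq> pverts G"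
  using FAT by (auto simp: FAT_coloring_def)

lemma class_obtain:
  assumes "v \<in> pverts G"
  obtains i where "i \<in> {1..k}" "v \<in> V i"
proof -
  have "v \<in> (\<Union>i\<in>{1..k}. V i)" using assms FAT by (simp add: FAT_coloring_def)
  then show thesis using that by blast
qed

lemma edges_to_eq_0_iff:
  assumes "i \<in> {1..k}"
  shows "edges_to G v (V i) = 0 \<longleftrightarrow> (\<forall>u\<in>V i. (v, u) \<notin> parcs G)"
proof -
  have "finite (V i \<inter> nbhd G v)" using finite_pverts by (simp add: nbhd_def)
  then show ?thesis using class_sub[OF assms] by (auto simp: edges_to_def nbhd_def)
qed

text \<open>An isolated vertex would be closed under adjacency and hence the only vertex, leaving no
  room for two disjoint nonempty classes.\<close>

lemma vdeg_pos:
  assumes "v \<in> pverts G"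
  shows "vdeg G v > 0"
proof (rule ccontr)
  assume "\<not> vdeg G v > 0"
  moreover have "finite (nbhd G v)" using finite_pverts by (simp add: nbhd_def)
  ultimately have "nbhd G v = {}" by (simp add: vdeg_def)
  then have "(v, u) \<notin> parcs G" for u
    using pair_wf_digraph.in_arcsD2 graph
    by (fastforce simp: nbhd_def pair_graph_def pair_digraph_def pair_fin_digraph_def)
  then have "{v} = pverts G"
    using assms by (intro connected_closed_set[OF graph conn]) auto
  then have "V i = {v}" if "i \<in> {1..k}" for i
    using class_ne[OF that] class_sub[OF that] subset_singletonD by metis
  from this[of 1] this[of 2] class_disjoint[of 1 2] show False using k2 by simp
qed

text \<open>A missing neighbor forces \<alpha> = 0, because \<open>v\<close> has positive degree.
  Then no arc leaves \<open>V i\<close>, so by connectedness \<open>V i\<close> is the whole vertex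
  set, although it misses \<open>v\<close>.\<close>

lemma neighbor_in_other_class:
  assumes v: "v \<in> pverts G" and i: "i \<in> {1..k}" "v \<notin> V i"
  shows "\<exists>u\<in>V i. (v, u) \<in> parcs G"
proof (rule ccontr)
  assume "\<not> ?thesis"
  then have 0: "edges_to G v (V i) = 0" using edges_to_eq_0_iff i by blast
  obtain \<alpha> where \<alpha>: "\<And>w j. w \<in> pverts G \<Longrightarrow> j \<in> {1..k} \<Longrightarrow> w \<notin> V j \<Longrightarrow>
      real (edges_to G w (V j)) = \<alpha> * real (vdeg G w)"
    using FAT unfolding FAT_coloring_def by blast
  have "\<alpha> = 0" using \<alpha>[OF v i] 0 vdeg_pos[OF v] by simp
  have "V i = pverts G"
  proof (rule connected_closed_set[OF graph conn class_sub[OF i(1)] class_ne[OF i(1)]])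
    fix w u assume w: "w \<in> V i" "(w, u) \<in> parcs G"
    have u: "u \<in> pverts G"
      using w graph pair_wf_digraph.in_arcsD2
      by (fastforce simp: pair_graph_def pair_digraph_def pair_fin_digraph_def)
    then obtain j where j: "j \<in> {1..k}" "u \<in> V j" by (rule class_obtain)
    show "u \<in> V i"
    proof (rule ccontr)
      assume "u \<notin> V i"
      then have "w \<notin> V j" using class_disjoint[OF i(1) j(1)] w(1) j(2) by blast
      then have "edges_to G w (V j) = 0"
        using \<alpha>[of w j] \<open>\<alpha> = 0\<close> class_sub[OF i(1)] w(1) j(1) by auto
      then show False using edges_to_eq_0_iff j w(2) by blast
    qed
  qed
  then show False using v i by blast
qed

text \<open>Each of the \<open>k - 1\<close> foreign classes takes at least one unit of the degree
  of \<open>v\<close>.\<close>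

lemma own_class_edges_bound:
  assumes v: "v \<in> pverts G" and i: "i \<in> {1..k}" "v \<in> V i"
  shows "edges_to G v (V i) + (k - 1) \<le> vdeg G v"
proof -
  have "k - 1 = (\<Sum>j\<in>{1..k} - {i}. 1)" using i by simp
  also have "\<dots> \<le> (\<Sum>j\<in>{1..k} - {i}. edges_to G v (V j))"
  proof (rule sum_mono)
    fix j assume j: "j \<in> {1..k} - {i}"
    then have "v \<notin> V j" using class_disjoint i by blast
    then have "edges_to G v (V j) \<noteq> 0"
      using neighbor_in_other_class[OF v] edges_to_eq_0_iff j by blast
    then show "1 \<le> edges_to G v (V j)" by simp
  qed
  finally have "edges_to G v (V i) + (k - 1) \<le> (\<Sum>j\<in>{1..k}. edges_to G v (V j))"
    using sum.remove[OF _ i(1), of "\<lambda>j. edges_to G v (V j)"] by simp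
  then show ?thesis using sum_edges_to_classes[OF finite_pverts FAT] by simp
qed

lemma colors_le_Suc_vdeg:
  assumes "v \<in> pverts G"
  shows "k \<le> vdeg G v + 1"
proof -
  obtain i where "i \<in> {1..k}" "v \<in> V i" using assms by (rule class_obtain)
  from own_class_edges_bound[OF assms this] show ?thesis by simp
qed

text \<open>Equality at \<open>v\<close> leaves no edge from \<open>v\<close> into its own class, so
  \<beta> = 0; as \<beta> is common to all vertices, every class is independent.\<close>

lemma classes_independent:
  assumes v: "v \<in> pverts G" and eq: "k = vdeg G v + 1"
    and i: "i \<in> {1..k}" "u \<in> V i" "w \<in> V i"
  shows "(u, w) \<notin> parcs G"
proof -
  obtain \<beta> where \<beta>: "\<And>x j. x \<in> pverts G \<Longrightarrow> j \<in> {1..k} \<Longrightarrow> x \<in> V j \<Longrightarrow>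
      real (edges_to G x (V j)) = \<beta> * real (vdeg G x)"
    using FAT unfolding FAT_coloring_def by blast
  obtain j where j: "j \<in> {1..k}" "v \<in> V j" using v by (rule class_obtain)
  have "edges_to G v (V j) = 0" using own_class_edges_bound[OF v j] eq by simp
  then have "\<beta> = 0" using \<beta>[OF v j] vdeg_pos[OF v] by simp
  then have "edges_to G u (V i) = 0" using \<beta>[of u i] i class_sub[of i] by auto
  then show ?thesis using edges_to_eq_0_iff i by blast
qed

end

lemma FAT_chromatic_number_eqI:
  assumes "finite (pverts G)" "FAT_coloring G k V"
    and "\<And>l W. FAT_coloring G l W \<Longrightarrow> l \<le> k"
  shows "FAT_chromatic_number G = k"
  unfolding FAT_chromatic_number_def
  using assms by (intro Max_eqI finite_FAT_colorings) auto

lemma chromatic_number_eqI: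
  assumes "proper_coloring G k c" "\<And>l d. proper_coloring G l d \<Longrightarrow> k \<le> l"
  shows "chromatic_number G = k"
  unfolding chromatic_number_def using assms by (intro Least_equality) auto

section \<open>The two graphs\<close>

definition graph_on :: "nat \<Rightarrow> (nat \<Rightarrow> nat \<Rightarrow> bool) \<Rightarrow> nat pair_pre_digraph" where
  "graph_on m R = \<lparr>pverts = {..<m}, parcs = {(x, y). x < m \<and> y < m \<and> R x y}\<rparr>"

lemma pverts_graph_on [simp]: "pverts (graph_on m R) = {..<m}"
  by (simp add: graph_on_def)

lemma parcs_graph_on [simp]: "(x, y) \<in> parcs (graph_on m R) \<longleftrightarrow> x < m \<and> y < m \<and> R x y"
  by (simp add: graph_on_def)

lemma nbhd_graph_on: "x < m \<Longrightarrow> nbhd (graph_on m R) x = {y. y < m \<and> R x y}"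
  by (auto simp: nbhd_def)

lemma pair_graph_graph_on:
  assumes "symp R" "irreflp R"
  shows "pair_graph (graph_on m R)"
proof unfold_locales
  have "parcs (graph_on m R) \<subseteq> {..<m} \<times> {..<m}" by (auto simp: graph_on_def)
  then show "finite (parcs (graph_on m R))" by (rule finite_subset) simp
  show "symmetric (with_proj (graph_on m R))"
    using assms(1) by (auto simp: symmetric_def sym_def symp_def)
qed (use assms(2) in \<open>auto simp: graph_on_def irreflp_def\<close>)

text \<open>The sides are the even and the odd numbers, so that consecutive pairs give a perfect
  matching.\<close>

definition balanced_bipartite :: "nat \<Rightarrow> nat pair_pre_digraph" where
  "balanced_bipartite n = graph_on (2 * n) (\<lambda>x y. even x \<noteq> even y)"

text \<open>
  The vertices 2a and 2a+1 are the copies of vertex a of the graph formed by the clique on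
  {..<n} and the vertex n attached to 0.
\<close>

definition doubled_pendant_clique :: "nat \<Rightarrow> nat pair_pre_digraph" where
  "doubled_pendant_clique n = graph_on (2 * n + 2)
     (\<lambda>x y. x div 2 \<noteq> y div 2 \<and> (x < 2 * n \<and> y < 2 * n \<or> x < 2 \<or> y < 2))"

section \<open>Simplicity and connectedness\<close>

lemma pair_graph_balanced_bipartite: "pair_graph (balanced_bipartite n)"
  unfolding balanced_bipartite_def
  by (rule pair_graph_graph_on) (auto simp: symp_def irreflp_def)

lemma pair_graph_doubled_pendant_clique: "pair_graph (doubled_pendant_clique n)"
  unfolding doubled_pendant_clique_def
  by (rule pair_graph_graph_on) (auto simp: symp_def irreflp_def)

lemma connected_balanced_bipartite:
  assumes "n \<ge> 1"
  shows "Digraph_Component.connected (balanced_bipartite n)"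
proof (rule connected_if_near_vertex[OF pair_graph_balanced_bipartite, of 0])
  fix v assume "v \<in> pverts (balanced_bipartite n)"
  then show "v = 0 \<or> (v, 0) \<in> parcs (balanced_bipartite n) \<or>
      (\<exists>w. (v, w) \<in> parcs (balanced_bipartite n) \<and> (w, 0) \<in> parcs (balanced_bipartite n))"
    \<comment> \<open>Odd vertices are adjacent to 0; even ones reach 0 through 1.\<close>
    using assms by (cases "even v") (auto simp: balanced_bipartite_def intro!: exI[of _ 1])
qed (use assms in \<open>simp add: balanced_bipartite_def\<close>)

lemma connected_doubled_pendant_clique:
  assumes "n \<ge> 2"
  shows "Digraph_Component.connected (doubled_pendant_clique n)"
proof (rule connected_if_near_vertex[OF pair_graph_doubled_pendant_clique, of 0])
  fix v assume v: "v \<in> pverts (doubled_pendant_clique n)"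
  consider "v = 0" | "v = 1" | "v \<ge> 2" by linarith
  then show "v = 0 \<or> (v, 0) \<in> parcs (doubled_pendant_clique n) \<or>
      (\<exists>w. (v, w) \<in> parcs (doubled_pendant_clique n) \<and> (w, 0) \<in> parcs (doubled_pendant_clique n))"
  proof cases
    \<comment> \<open>The twin 1 of 0 is the only vertex not adjacent to 0 other than 0 itself; the
      two share the neighbor 2.\<close>
    case 2
    then show ?thesis using assms by (auto simp: doubled_pendant_clique_def intro!: exI[of _ 2])
  qed (use v in \<open>auto simp: doubled_pendant_clique_def\<close>)
qed (simp add: doubled_pendant_clique_def)

section \<open>Ordinary chromatic numbers\<close>

lemma chromatic_number_balanced_bipartite:
  assumes "n \<ge> 1"
  shows "chromatic_number (balanced_bipartite n) = 2"
proof (rule chromatic_number_eqI)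
  show "proper_coloring (balanced_bipartite n) 2 (\<lambda>x. if even x then 1 else 2)"
    by (auto simp: proper_coloring_def balanced_bipartite_def)
next
  fix l d assume d: "proper_coloring (balanced_bipartite n) l d"
  have "(0, 1) \<in> parcs (balanced_bipartite n)" "0 \<in> pverts (balanced_bipartite n)"
    "1 \<in> pverts (balanced_bipartite n)"
    using assms by (auto simp: balanced_bipartite_def)
  then have "d 0 \<noteq> d 1" "d 0 \<in> {1..l}" "d 1 \<in> {1..l}"
    using d unfolding proper_coloring_def by blast+
  then show "2 \<le> l" by auto
qed

lemma chromatic_number_doubled_pendant_clique:
  assumes "n \<ge> 2"
  shows "chromatic_number (doubled_pendant_clique n) = n"
proof (rule chromatic_number_eqI)
  \<comment> \<open>Twins in the clique part share a color. The pendant copies see only 0 and 1,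
    both colored 1, so color 2 is free for them.\<close>
  let ?c = "\<lambda>x. if x < 2 * n then x div 2 + 1 else 2"
  have "?c x \<noteq> ?c y" if "(x, y) \<in> parcs (doubled_pendant_clique n)" for x y
    using that assms by (auto simp: doubled_pendant_clique_def split: if_splits)
  moreover have "?c ` pverts (doubled_pendant_clique n) \<subseteq> {1..n}"
    using assms by (auto simp: doubled_pendant_clique_def)
  ultimately show "proper_coloring (doubled_pendant_clique n) n ?c"
    unfolding proper_coloring_def by blast
next
  fix l d assume d: "proper_coloring (doubled_pendant_clique n) l d"
  \<comment> \<open>One copy of each clique vertex, here the even one, gives a clique of size
    \<open>n\<close>.\<close>
  have arc: "(2 * i, 2 * j) \<in> parcs (doubled_pendant_clique n)" if "i < n" "j < n" "i \<noteq> j" for i j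
    using that by (auto simp: doubled_pendant_clique_def)
  have "inj_on (\<lambda>i. d (2 * i)) {..<n}"
    using d arc unfolding proper_coloring_def inj_on_def by blast
  moreover have "(\<lambda>i. d (2 * i)) ` {..<n} \<subseteq> {1..l}"
    using d by (auto simp: proper_coloring_def doubled_pendant_clique_def)
  ultimately have "card {..<n} \<le> card {1..l}" by (intro card_inj_on_le) auto
  then show "n \<le> l" by simp
qed

section \<open>FAT colorings of the complete bipartite graph\<close>

lemma card_opposite_parity:
  "card {y. y < 2 * n \<and> even x \<noteq> even y} = n" for x n :: nat
proof -
  have "bij_betw (\<lambda>i. 2 * i + (if even x then 1 else 0)) {..<n} {y. y < 2 * n \<and> even x \<noteq> even y}"
    by (rule bij_betw_byWitness[where f' = "\<lambda>y. y div 2"]) auto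
  then show ?thesis using bij_betw_same_card by fastforce
qed

lemma vdeg_balanced_bipartite: "x < 2 * n \<Longrightarrow> vdeg (balanced_bipartite n) x = n"
  unfolding vdeg_def balanced_bipartite_def by (simp only: nbhd_graph_on card_opposite_parity)

text \<open>A class holds one vertex of each side, so every vertex has exactly one neighbor in each
  class, its own included; thus \<alpha> = \<beta> = 1/n. Indices start at 1, so the subtractions do
  not truncate.\<close>

lemma FAT_coloring_balanced_bipartite:
  assumes "n \<ge> 1"
  shows "FAT_coloring (balanced_bipartite n) n (\<lambda>i. {2 * i - 2, 2 * i - 1})"
proof -
  let ?G = "balanced_bipartite n" and ?V = "\<lambda>i. {2 * i - 2, 2 * i - 1} :: nat set"
  have one: "edges_to ?G v (?V i) = 1" if "v < 2 * n" "i \<in> {1..n}" for v i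
  proof -
    have "?V i \<inter> nbhd ?G v = {if even v then 2 * i - 1 else 2 * i - 2}"
      using that by (auto simp: balanced_bipartite_def nbhd_graph_on)
    then show ?thesis by (simp add: edges_to_def)
  qed
  have "x \<in> (\<Union>i\<in>{1..n}. ?V i)" if "x < 2 * n" for x
    using that by (intro UN_I[of "x div 2 + 1"]) auto
  then have "(\<Union>i\<in>{1..n}. ?V i) = pverts ?G" by (auto simp: balanced_bipartite_def)
  moreover have "disjoint_family_on ?V {1..n}"
    by (auto simp: disjoint_family_on_def)
  moreover have "v < 2 * n \<Longrightarrow> i \<in> {1..n} \<Longrightarrow> real (edges_to ?G v (?V i)) = 1 / n * real (vdeg ?G v)" for v i
    using one[of v i] vdeg_balanced_bipartite[of v n] assms by simp
  ultimately show ?thesis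
    using assms unfolding FAT_coloring_def
    by (intro conjI bexI[of _ "1 / real n"]) (auto simp: balanced_bipartite_def)
qed

text \<open>The degree bound leaves only \<open>k = n + 1\<close>, where classes are independent.
  Since \<open>k\<close> is at least 3, some class avoids both 0 and 1; it contains a neighbor of
  each, and these lie on opposite sides and are adjacent.\<close>

lemma FAT_balanced_bipartite_le:
  assumes "n \<ge> 2" "FAT_coloring (balanced_bipartite n) k V"
  shows "k \<le> n"
proof (rule ccontr)
  assume "\<not> k \<le> n"
  let ?G = "balanced_bipartite n"
  interpret connected_FAT ?G k V
    using assms \<open>\<not> k \<le> n\<close>
    by (intro connected_FAT.intro pair_graph_balanced_bipartite connected_balanced_bipartite) simp_all
  have v: "0 \<in> pverts ?G" "1 \<in> pverts ?G" using assms by (auto simp: balanced_bipartite_def)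
  have k: "k = vdeg ?G 0 + 1"
    using colors_le_Suc_vdeg[OF v(1)] vdeg_balanced_bipartite[of 0 n] assms \<open>\<not> k \<le> n\<close> by simp
  obtain a b where a: "a \<in> {1..k}" "0 \<in> V a" and b: "b \<in> {1..k}" "1 \<in> V b"
    using v class_obtain by metis
  have "\<not> {1..k} \<subseteq> {a, b}"
  proof
    assume "{1..k} \<subseteq> {a, b}"
    then have "card {1..k} \<le> card {a, b}" by (intro card_mono) auto
    also have "\<dots> \<le> 2" by (simp add: card_insert_if)
    finally show False using assms \<open>\<not> k \<le> n\<close> by simp
  qed
  then obtain m where m: "m \<in> {1..k}" "m \<noteq> a" "m \<noteq> b" by blast
  then have "0 \<notin> V m" "1 \<notin> V m" using class_disjoint a b by blast+
  then obtain x y where x: "x \<in> V m" "(0, x) \<in> parcs ?G" and y: "y \<in> V m" "(1, y) \<in> parcs ?G"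
    using neighbor_in_other_class[OF _ m(1)] v by blast
  then have "(x, y) \<in> parcs ?G" by (auto simp: balanced_bipartite_def)
  then show False using classes_independent[OF v(1) k m(1) x(1) y(1)] by blast
qed

section \<open>FAT colorings of the doubled graph\<close>

lemma FAT_coloring_doubled_pendant_clique:
  "FAT_coloring (doubled_pendant_clique n) 2 (\<lambda>i. {x. x < 2 * n + 2 \<and> (even x \<longleftrightarrow> i = 1)})"
proof -
  let ?G = "doubled_pendant_clique n"
  let ?V = "\<lambda>i :: nat. {x. x < 2 * n + 2 \<and> (even x \<longleftrightarrow> i = 1)} :: nat set"
  have I: "{1..2} = {1, 2 :: nat}" by auto
  have half: "2 * edges_to ?G v (?V i) = vdeg ?G v" if v: "v < 2 * n + 2" and i: "i \<in> {1, 2}" for v i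
  proof -
    let ?N = "nbhd ?G v"
    \<comment> \<open>The involution \<open>p\<close> exchanges twins. Adjacency depends only on
      \<open>x div 2\<close>, so \<open>p\<close> preserves each neighborhood while swapping the two
      parity classes; each class therefore receives half of every degree.\<close>
    define p where "p x = (if even x then x + 1 else x - 1)" for x :: nat
    have p: "p x div 2 = x div 2" "even (p x) \<longleftrightarrow> odd x" "p (p x) = x" for x
      unfolding p_def by presburger+
    have p_less: "p x < 2 * m \<longleftrightarrow> x < 2 * m" for x m
      unfolding p_def by presburger
    have N: "p x \<in> ?N" if "x \<in> ?N" for x
      \<comment> \<open>The three instances match the thresholds \<open>2 * n\<close>, 2 and
        \<open>2 * n + 2\<close> in the definition of the graph.\<close>
      using that v p(1)[of x] p_less[of x n] p_less[of x 1] p_less[of x "n + 1"]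
      by (simp add: doubled_pendant_clique_def nbhd_graph_on)
    have V: "p x < 2 * n + 2 \<longleftrightarrow> x < 2 * n + 2" for x
      using p_less[of x "n + 1"] by simp
    have "bij_betw p (?V 1 \<inter> ?N) (?V 2 \<inter> ?N)"
    proof (rule bij_betw_byWitness[where f' = p])
      show "p ` (?V 1 \<inter> ?N) \<subseteq> ?V 2 \<inter> ?N" "p ` (?V 2 \<inter> ?N) \<subseteq> ?V 1 \<inter> ?N"
        using N V p(2) by (simp_all add: image_subset_iff)
    qed (simp_all add: p(3))
    then have eq: "card (?V 1 \<inter> ?N) = card (?V 2 \<inter> ?N)" by (rule bij_betw_same_card)
    have "?N = (?V 1 \<inter> ?N) \<union> (?V 2 \<inter> ?N)"
      by (auto simp: doubled_pendant_clique_def nbhd_def)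
    moreover have "card ((?V 1 \<inter> ?N) \<union> (?V 2 \<inter> ?N)) = card (?V 1 \<inter> ?N) + card (?V 2 \<inter> ?N)"
      by (rule card_Un_disjoint) auto
    ultimately have "vdeg ?G v = card (?V 1 \<inter> ?N) + card (?V 2 \<inter> ?N)"
      by (simp add: vdeg_def)
    then show ?thesis using eq i unfolding edges_to_def by fastforce
  qed
  have "real (edges_to ?G v (?V i)) = 1 / 2 * real (vdeg ?G v)"
    if "v < 2 * n + 2" "i \<in> {1, 2}" for v i
    using half[OF that] by linarith
  moreover have "0 \<in> ?V 1" "1 \<in> ?V 2" by auto
  then have "\<forall>i\<in>{1, 2}. ?V i \<noteq> {}" by blast
  moreover have "disjoint_family_on ?V {1, 2}"
    by (auto simp: disjoint_family_on_def)
  moreover have "(\<Union>i\<in>{1, 2}. ?V i) = pverts ?G"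
    by (auto simp: doubled_pendant_clique_def)
  ultimately show ?thesis
    unfolding FAT_coloring_def I
    by (intro conjI bexI[of _ "1 / 2"]) (simp_all add: doubled_pendant_clique_def)
qed

text \<open>The pendant copy \<open>2 * n\<close> has degree 2, so more than two classes means
  exactly three, all independent. They cannot separate the clique on 0, 2, 4, 6, which exists
  because \<open>n\<close> is at least 4.\<close>

lemma FAT_doubled_pendant_clique_le:
  assumes "n \<ge> 4" "FAT_coloring (doubled_pendant_clique n) k V"
  shows "k \<le> 2"
proof (rule ccontr)
  assume "\<not> k \<le> 2"
  let ?G = "doubled_pendant_clique n"
  interpret connected_FAT ?G k V
    using assms \<open>\<not> k \<le> 2\<close>
    by (intro connected_FAT.intro pair_graph_doubled_pendant_clique connected_doubled_pendant_clique)
      simp_all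
  have v: "2 * n \<in> pverts ?G" by (simp add: doubled_pendant_clique_def)
  have "nbhd ?G (2 * n) = {0, 1}"
    using assms by (auto simp: doubled_pendant_clique_def nbhd_graph_on)
  then have deg: "vdeg ?G (2 * n) = 2" by (simp add: vdeg_def)
  then have k: "k = vdeg ?G (2 * n) + 1"
    using colors_le_Suc_vdeg[OF v] \<open>\<not> k \<le> 2\<close> by simp
  \<comment> \<open>The class of the even copy of \<open>i\<close>; independence of the classes
    makes \<open>c\<close> injective on the four clique vertices.\<close>
  define c where "c i = (SOME j. j \<in> {1..k} \<and> 2 * i \<in> V j)" for i
  have c: "c i \<in> {1..k} \<and> 2 * i \<in> V (c i)" if "i < 4" for i
  proof -
    have "2 * i \<in> pverts ?G" using that assms by (simp add: doubled_pendant_clique_def)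
    then have "\<exists>j. j \<in> {1..k} \<and> 2 * i \<in> V j" using class_obtain by metis
    then show ?thesis unfolding c_def by (rule someI_ex)
  qed
  have "inj_on c {..<4}"
  proof (rule inj_onI, rule ccontr)
    fix i j assume ij: "i \<in> {..<4}" "j \<in> {..<4}" "c i = c j" "i \<noteq> j"
    have "(2 * i, 2 * j) \<in> parcs ?G"
      using ij assms by (auto simp: doubled_pendant_clique_def)
    moreover have "2 * j \<in> V (c i)" using c[of j] ij by simp
    ultimately show False
      using classes_independent[OF v k, of "c i" "2 * i" "2 * j"] c[of i] ij by auto
  qed
  moreover have "c ` {..<4} \<subseteq> {1..k}" using c by blast
  ultimately have "card {..<4 :: nat} \<le> card {1..k}" by (intro card_inj_on_le) auto
  then show False using k deg by simp
qed

theorem theorem2p3: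
  fixes n :: nat
  assumes "odd n" and "n \<ge> 5"
  shows "\<exists>(G1 :: nat pair_pre_digraph) (G2 :: nat pair_pre_digraph).
           pair_graph G1 \<and> Digraph_Component.connected G1 \<and>
           pair_graph G2 \<and> Digraph_Component.connected G2 \<and>
           chromatic_number G1 = 2 \<and> FAT_chromatic_number G1 = n \<and>
           chromatic_number G2 = n \<and> FAT_chromatic_number G2 = 2"
proof (intro exI conjI)
  show "pair_graph (balanced_bipartite n)"
    by (rule pair_graph_balanced_bipartite)
  show "Digraph_Component.connected (balanced_bipartite n)"
    using assms by (intro connected_balanced_bipartite) simp
  show "pair_graph (doubled_pendant_clique n)"
    by (rule pair_graph_doubled_pendant_clique)
  show "Digraph_Component.connected (doubled_pendant_clique n)"
    using assms by (intro connected_doubled_pendant_clique) simp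
  show "chromatic_number (balanced_bipartite n) = 2"
    using assms by (intro chromatic_number_balanced_bipartite) simp
  show "chromatic_number (doubled_pendant_clique n) = n"
    using assms by (intro chromatic_number_doubled_pendant_clique) simp
  show "FAT_chromatic_number (balanced_bipartite n) = n"
  proof (rule FAT_chromatic_number_eqI)
    show "finite (pverts (balanced_bipartite n))" by (simp add: balanced_bipartite_def)
    show "FAT_coloring (balanced_bipartite n) n (\<lambda>i. {2 * i - 2, 2 * i - 1})"
      using assms by (intro FAT_coloring_balanced_bipartite) simp
  qed (use assms FAT_balanced_bipartite_le in auto)
  show "FAT_chromatic_number (doubled_pendant_clique n) = 2"
  proof (rule FAT_chromatic_number_eqI[OF _ FAT_coloring_doubled_pendant_clique])
    show "finite (pverts (doubled_pendant_clique n))" by (simp add: doubled_pendant_clique_def)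
    show "l \<le> 2" if "FAT_coloring (doubled_pendant_clique n) l W" for l W
      using FAT_doubled_pendant_clique_le[OF _ that] assms by simp
  qed
qed

end
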